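(* Let $\mathcal{Q}$ be an admissible quantifier prefix and let $\mathcal{Q}\varphi$ be a state formula of $\mathcal{L}_{\mathrm{HDMAS}}$. Then $\mathsf{push}(\mathcal{Q},\varphi)\equiv_{fin}\mathcal{Q}\varphi$.
   Context: HDMAS models: $\mathcal{M}=\langle\mathit{Ag},\mathit{Act}^+,S,d,\delta,\mathit{AP},\lambda\rangle$ with states $S$, actions $\mathit{Act}^+=\{act_1,\dots,act_n,\varepsilon\}$, available actions $d(s)\ni\varepsilon$, and transitions determined by quantifier-free Presburger guards $\delta(s,s')$ over the numbers $x_i$ of agents performing $act_i$ (each vector of counts over the available actions satisfies exactly one outgoing guard); $\lambda:S\to\mathcal{P}(\mathit{AP})$. An abstract joint strategy for $C$ agents assigns to each state a distribution of $C$ agents over its available actions. $\mathcal{M},s,\theta\models\langle\langle t_1,t_2\rangle\rangle\chi$ iff some abstract joint strategy for $\theta(t_1)$ agents guarantees that every play from $s$ (where at each state the successor is determined by the sum of the strategy's distribution and an arbitrary distribution of $\theta(t_2)$ further agents over the available actions) satisfies $\chi$, with $\mathsf{X},\mathsf{G},\mathsf{U}$ standard along plays; $p$ true iff $p\in\lambda(s)$; Booleans standard; quantifiers range over $\mathbb{N}$. Syntax: terms $T=\{y_1,y_2\}\cup\{z_1,z_2,\dots\}\cup\mathbb{N}$; assignments $\theta:T\to\mathbb{N}$ fixing numerals. Path formulas: $\mathsf{X}\varphi$, $\mathsf{G}\varphi$, $\psi\,\mathsf{U}\,\varphi$. State formulas: $\varphi::=\top\mid p\mid\neg\varphi\mid\varphi\wedge\varphi\mid\varphi\vee\varphi\mid\langle\langle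 t_1,t_2\rangle\rangle\chi\mid\mathcal{Q}\varphi$, $t_1\in T\setminus\{y_2\}$, $t_2\in T\setminus\{y_1\}$, where an admissible quantifier prefix $\mathcal{Q}$ is a string $\mathsf{Q}y_i$ or $\mathsf{Q}y_i\mathsf{Q}'y_j$ ($\mathsf{Q},\mathsf{Q}'\in\{\forall,\exists\}$, $i\neq j\in\{1,2\}$), and all free occurrences in $\varphi$ of variables quantified by $\mathcal{Q}$ must be positive (in the scope of an even number of negations). $\varphi\equiv_{fin}\psi$ means $\mathcal{M},s,\theta\models\varphi$ iff $\mathcal{M},s,\theta\models\psi$ for every HDMAS $\mathcal{M}$ with finite state space, state $s$ and assignment $\theta$. The function $\mathsf{push}(\mathcal{Q},\xi)$ ($\mathcal{Q}$ admissible prefix, $\xi$ a state or path formula; $\overline{\mathcal{Q}}$ is $\mathcal{Q}$ with each quantifier replaced by its dual): $\mathsf{push}(\mathcal{Q},\top)=\top$, $\mathsf{push}(\mathcal{Q},p)=p$; $\mathsf{push}(\mathcal{Q},\neg\psi)=\neg\mathsf{push}(\overline{\mathcal{Q}},\psi)$; $\mathsf{push}$ distributes over $\wedge,\vee$, and $\mathsf{push}(\mathcal{Q},\mathsf{X}\psi)=\mathsf{X}\,\mathsf{push}(\mathcal{Q},\psi)$, likewise for $\mathsf{G}$, and $\mathsf{push}(\mathcal{Q},\psi_1\mathsf{U}\psi_2)=\mathsf{push}(\mathcal{Q},\psi_1)\,\mathsf{U}\,\mathsf{push}(\mathcal{Q},\psi_2)$. For $\xi=\langle\langle t_1,t_2\rangle\rangle\chi$: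 if $\mathcal{Q}=\mathsf{Q}y_i$ with $t_i=y_i$, or $\mathcal{Q}$ is $\mathsf{Q}y_1\mathsf{Q}'y_2$ or $\mathsf{Q}'y_2\mathsf{Q}y_1$ with $t_1=y_1$ and $t_2=y_2$, return $\mathcal{Q}\langle\langle t_1,t_2\rangle\rangle\mathsf{push}(\mathcal{Q},\chi)$; if $\mathcal{Q}=\mathsf{Q}y_i$ with $t_i\ne y_i$, or $\mathcal{Q}$ is $\mathsf{Q}y_1\mathsf{Q}'y_2$ or $\mathsf{Q}'y_2\mathsf{Q}y_1$ with $t_1\ne y_1$, $t_2\ne y_2$, return $\langle\langle t_1,t_2\rangle\rangle\mathsf{push}(\mathcal{Q},\chi)$; if $\mathcal{Q}$ is $\mathsf{Q}y_1\mathsf{Q}'y_2$ or $\mathsf{Q}'y_2\mathsf{Q}y_1$ with $t_1=y_1$, $t_2\neq y_2$, return $\mathsf{Q}y_1\langle\langle t_1,t_2\rangle\rangle\mathsf{push}(\mathcal{Q},\chi)$; if instead $t_1\neq y_1$, $t_2=y_2$, return $\mathsf{Q}'y_2\langle\langle t_1,t_2\rangle\rangle\mathsf{push}(\mathcal{Q},\chi)$. For $\xi=\mathsf{Q}''y_k\psi$: if $\mathcal{Q}=\mathsf{Q}y_i$ with $i=k$, return $\mathsf{push}(\mathsf{Q}''y_k,\psi)$; if $\mathcal{Q}=\mathsf{Q}y_i$ with $i\ne k$, return $\mathsf{push}(\mathsf{Q}y_i\mathsf{Q}''y_k,\psi)$; if $\mathcal{Q}=\mathsf{Q}y_i\mathsf{Q}'y_j$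 with $i=k$, return $\mathsf{push}(\mathsf{Q}'y_j\mathsf{Q}''y_k,\psi)$; if $\mathcal{Q}=\mathsf{Q}y_i\mathsf{Q}'y_j$ with $j=k$, return $\mathsf{push}(\mathsf{Q}y_i\mathsf{Q}''y_k,\psi)$. *)

theory Defs
  imports Main
begin

datatype action = Act nat | Idle

datatype pterm =
    Const nat
  | Counter nat
  | Add pterm pterm

datatype guard =
    GEq pterm pterm
  | GLess pterm pterm
  | GNeg guard
  | GConj guard guard
  | GDisj guard guard

text \<open>There is no counter for the number of idle agents.\<close>

primrec pval :: "(action \<Rightarrow> nat) \<Rightarrow> pterm \<Rightarrow> nat" where
  "pval f (Const k) = k"
| "pval f (Counter i) = f (Act i)"
| "pval f (Add t u) = pval f t + pval f u"

primrec guard_sat :: "(action \<Rightarrow> nat) \<Rightarrow> guard \<Rightarrow> bool" where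
  "guard_sat f (GEq t u) \<longleftrightarrow> pval f t = pval f u"
| "guard_sat f (GLess t u) \<longleftrightarrow> pval f t < pval f u"
| "guard_sat f (GNeg g) \<longleftrightarrow> \<not> guard_sat f g"
| "guard_sat f (GConj g h) \<longleftrightarrow> guard_sat f g \<and> guard_sat f h"
| "guard_sat f (GDisj g h) \<longleftrightarrow> guard_sat f g \<or> guard_sat f h"

primrec pterm_counters :: "pterm \<Rightarrow> nat set" where
  "pterm_counters (Const k) = {}"
| "pterm_counters (Counter i) = {i}"
| "pterm_counters (Add t u) = pterm_counters t \<union> pterm_counters u"

primrec guard_counters :: "guard \<Rightarrow> nat set" where
  "guard_counters (GEq t u) = pterm_counters t \<union> pterm_counters u"
| "guard_counters (GLess t u) = pterm_counters t \<union> pterm_counters u"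
| "guard_counters (GNeg g) = guard_counters g"
| "guard_counters (GConj g h) = guard_counters g \<union> guard_counters h"
| "guard_counters (GDisj g h) = guard_counters g \<union> guard_counters h"

text \<open>
  The semantics refers only to numbers of agents, never to the set \<open>agents\<close> itself.
  The proper actions are \<open>Act 1, \<dots>, Act n\<close> with \<open>n\<close> the field \<open>nacts\<close>.
\<close>

record ('ag, 's, 'p) hdmas =
  agents :: "'ag set"
  nacts :: nat
  states :: "'s set"
  avail :: "'s \<Rightarrow> action set"
  guard_of :: "'s \<Rightarrow> 's \<Rightarrow> guard"
  props :: "'p set"
  label :: "'s \<Rightarrow> 'p set"

definition actions :: "('ag, 's, 'p) hdmas \<Rightarrow> action set" where
  "actions M = insert Idle (Act ` {1..nacts M})"

definition profile :: "('ag, 's, 'p) hdmas \<Rightarrow> 's \<Rightarrow> (action \<Rightarrow> nat) \<Rightarrow> bool" where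
  "profile M s f \<longleftrightarrow> (\<forall>a. a \<notin> avail M s \<longrightarrow> f a = 0)"

definition distribution ::
    "('ag, 's, 'p) hdmas \<Rightarrow> 's \<Rightarrow> nat \<Rightarrow> (action \<Rightarrow> nat) \<Rightarrow> bool" where
  "distribution M s c f \<longleftrightarrow> profile M s f \<and> (\<Sum>a\<in>avail M s. f a) = c"

definition is_hdmas :: "('ag, 's, 'p) hdmas \<Rightarrow> bool" where
  "is_hdmas M \<longleftrightarrow>
     (\<forall>s\<in>states M.
        Idle \<in> avail M s \<and> avail M s \<subseteq> actions M \<and>
        label M s \<subseteq> props M \<and>
        (\<forall>s'\<in>states M. guard_counters (guard_of M s s') \<subseteq> {1..nacts M}) \<and>
        (\<forall>f. profile M s f \<longrightarrow> (\<exists>!s'. s' \<in> states M \<and> guard_sat f (guard_of M s s'))))"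

definition joint_strategy ::
    "('ag, 's, 'p) hdmas \<Rightarrow> nat \<Rightarrow> ('s \<Rightarrow> action \<Rightarrow> nat) \<Rightarrow> bool" where
  "joint_strategy M c \<sigma> \<longleftrightarrow> (\<forall>s\<in>states M. distribution M s c (\<sigma> s))"

definition play ::
    "('ag, 's, 'p) hdmas \<Rightarrow> ('s \<Rightarrow> action \<Rightarrow> nat) \<Rightarrow> nat \<Rightarrow> 's \<Rightarrow> (nat \<Rightarrow> 's) \<Rightarrow> bool" where
  "play M \<sigma> n s \<pi> \<longleftrightarrow>
     \<pi> 0 = s \<and>
     (\<forall>k. \<exists>g. distribution M (\<pi> k) n g \<and> \<pi> (Suc k) \<in> states M \<and>
        guard_sat (\<lambda>a. \<sigma> (\<pi> k) a + g a) (guard_of M (\<pi> k) (\<pi> (Suc k))))"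

datatype yvar = Y1 | Y2

datatype tm = YVar yvar | ZVar nat | Num nat

datatype quant = Forall | Exists

datatype 'p sform =
    Top
  | Atom 'p
  | Neg "'p sform"
  | Conj "'p sform" "'p sform"
  | Disj "'p sform" "'p sform"
  | Strat tm tm "'p pform"
  | Quant quant yvar "'p sform"
and 'p pform =
    Next "'p sform"
  | Always "'p sform"
  | Until "'p sform" "'p sform"

text \<open>
  The set of negation depths (numbers of enclosing negations) of the free occurrences
  of a variable in a formula.
\<close>

primrec neg_depths :: "yvar \<Rightarrow> 'p sform \<Rightarrow> nat set"
    and path_neg_depths :: "yvar \<Rightarrow> 'p pform \<Rightarrow> nat set" where
  "neg_depths y Top = {}"
| "neg_depths y (Atom p) = {}"
| "neg_depths y (Neg \<phi>) = Suc ` neg_depths y \<phi>"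
| "neg_depths y (Conj \<phi> \<psi>) = neg_depths y \<phi> \<union> neg_depths y \<psi>"
| "neg_depths y (Disj \<phi> \<psi>) = neg_depths y \<phi> \<union> neg_depths y \<psi>"
| "neg_depths y (Strat t1 t2 \<chi>) =
     (if t1 = YVar y \<or> t2 = YVar y then {0} else {}) \<union> path_neg_depths y \<chi>"
| "neg_depths y (Quant q x \<phi>) = (if x = y then {} else neg_depths y \<phi>)"
| "path_neg_depths y (Next \<phi>) = neg_depths y \<phi>"
| "path_neg_depths y (Always \<phi>) = neg_depths y \<phi>"
| "path_neg_depths y (Until \<psi> \<phi>) = neg_depths y \<psi> \<union> neg_depths y \<phi>"

definition positive_in :: "yvar \<Rightarrow> 'p sform \<Rightarrow> bool" where
  "positive_in y \<phi> \<longleftrightarrow> (\<forall>n\<in>neg_depths y \<phi>. even n)"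

text \<open>
  A prefix of two quantifiers is two nested applications of \<open>Quant\<close>. Since the two
  variables differ, the positivity conditions checked one quantifier at a time
  are those for the whole prefix.
\<close>

primrec state_formula :: "'p sform \<Rightarrow> bool"
    and path_formula :: "'p pform \<Rightarrow> bool" where
  "state_formula Top \<longleftrightarrow> True"
| "state_formula (Atom p) \<longleftrightarrow> True"
| "state_formula (Neg \<phi>) \<longleftrightarrow> state_formula \<phi>"
| "state_formula (Conj \<phi> \<psi>) \<longleftrightarrow> state_formula \<phi> \<and> state_formula \<psi>"
| "state_formula (Disj \<phi> \<psi>) \<longleftrightarrow> state_formula \<phi> \<and> state_formula \<psi>"
| "state_formula (Strat t1 t2 \<chi>) \<longleftrightarrow> t1 \<noteq> YVar Y2 \<and> t2 \<noteq> YVar Y1 \<and> path_formula \<chi>"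
| "state_formula (Quant q y \<phi>) \<longleftrightarrow> positive_in y \<phi> \<and> state_formula \<phi>"
| "path_formula (Next \<phi>) \<longleftrightarrow> state_formula \<phi>"
| "path_formula (Always \<phi>) \<longleftrightarrow> state_formula \<phi>"
| "path_formula (Until \<psi> \<phi>) \<longleftrightarrow> state_formula \<psi> \<and> state_formula \<phi>"

definition assignment :: "(tm \<Rightarrow> nat) \<Rightarrow> bool" where
  "assignment \<theta> \<longleftrightarrow> (\<forall>n. \<theta> (Num n) = n)"

primrec sat :: "('ag, 's, 'p) hdmas \<Rightarrow> 's \<Rightarrow> (tm \<Rightarrow> nat) \<Rightarrow> 'p sform \<Rightarrow> bool"
    and path_sat :: "('ag, 's, 'p) hdmas \<Rightarrow> (nat \<Rightarrow> 's) \<Rightarrow> (tm \<Rightarrow> nat) \<Rightarrow> 'p pform \<Rightarrow> bool" where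
  "sat M s \<theta> Top \<longleftrightarrow> True"
| "sat M s \<theta> (Atom p) \<longleftrightarrow> p \<in> label M s"
| "sat M s \<theta> (Neg \<phi>) \<longleftrightarrow> \<not> sat M s \<theta> \<phi>"
| "sat M s \<theta> (Conj \<phi> \<psi>) \<longleftrightarrow> sat M s \<theta> \<phi> \<and> sat M s \<theta> \<psi>"
| "sat M s \<theta> (Disj \<phi> \<psi>) \<longleftrightarrow> sat M s \<theta> \<phi> \<or> sat M s \<theta> \<psi>"
| "sat M s \<theta> (Strat t1 t2 \<chi>) \<longleftrightarrow>
     (\<exists>\<sigma>. joint_strategy M (\<theta> t1) \<sigma> \<and> (\<forall>\<pi>. play M \<sigma> (\<theta> t2) s \<pi> \<longrightarrow> path_sat M \<pi> \<theta> \<chi>))"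
| "sat M s \<theta> (Quant q y \<phi>) \<longleftrightarrow>
     (case q of
        Forall \<Rightarrow> \<forall>n. sat M s (\<theta>(YVar y := n)) \<phi>
      | Exists \<Rightarrow> \<exists>n. sat M s (\<theta>(YVar y := n)) \<phi>)"
| "path_sat M \<pi> \<theta> (Next \<phi>) \<longleftrightarrow> sat M (\<pi> 1) \<theta> \<phi>"
| "path_sat M \<pi> \<theta> (Always \<phi>) \<longleftrightarrow> (\<forall>k. sat M (\<pi> k) \<theta> \<phi>)"
| "path_sat M \<pi> \<theta> (Until \<psi> \<phi>) \<longleftrightarrow>
     (\<exists>k. sat M (\<pi> k) \<theta> \<phi> \<and> (\<forall>j<k. sat M (\<pi> j) \<theta> \<psi>))"

text \<open>The type argument fixes the types over which the quantified models range.\<close>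

definition equiv_fin ::
    "('ag, 's, 'p) hdmas itself \<Rightarrow> 'p sform \<Rightarrow> 'p sform \<Rightarrow> bool" where
  "equiv_fin _ \<phi> \<psi> \<longleftrightarrow>
     (\<forall>(M :: ('ag, 's, 'p) hdmas) s \<theta>.
        is_hdmas M \<and> finite (states M) \<and> s \<in> states M \<and> assignment \<theta> \<longrightarrow>
        sat M s \<theta> \<phi> = sat M s \<theta> \<psi>)"

datatype pfx = One quant yvar | Two quant yvar quant yvar

primrec admissible :: "pfx \<Rightarrow> bool" where
  "admissible (One q i) \<longleftrightarrow> True"
| "admissible (Two q i q' j) \<longleftrightarrow> i \<noteq> j"

primrec prefixed :: "pfx \<Rightarrow> 'p sform \<Rightarrow> 'p sform" where
  "prefixed (One q i) \<phi> = Quant q i \<phi>"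
| "prefixed (Two q i q' j) \<phi> = Quant q i (Quant q' j \<phi>)"

primrec dual_quant :: "quant \<Rightarrow> quant" where
  "dual_quant Forall = Exists"
| "dual_quant Exists = Forall"

primrec dual :: "pfx \<Rightarrow> pfx" where
  "dual (One q i) = One (dual_quant q) i"
| "dual (Two q i q' j) = Two (dual_quant q) i (dual_quant q') j"

text \<open>\<open>own i t1 t2\<close> states that the \<open>i\<close>-th of the two terms is the variable \<open>y\<^sub>i\<close>.\<close>

primrec own :: "yvar \<Rightarrow> tm \<Rightarrow> tm \<Rightarrow> bool" where
  "own Y1 t1 t2 \<longleftrightarrow> t1 = YVar Y1"
| "own Y2 t1 t2 \<longleftrightarrow> t2 = YVar Y2"

fun push :: "pfx \<Rightarrow> 'p sform \<Rightarrow> 'p sform"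
and push_path :: "pfx \<Rightarrow> 'p pform \<Rightarrow> 'p pform" where
  "push Q Top = Top"
| "push Q (Atom p) = Atom p"
| "push Q (Neg \<psi>) = Neg (push (dual Q) \<psi>)"
| "push Q (Conj \<phi> \<psi>) = Conj (push Q \<phi>) (push Q \<psi>)"
| "push Q (Disj \<phi> \<psi>) = Disj (push Q \<phi>) (push Q \<psi>)"
| "push (One q i) (Strat t1 t2 \<chi>) =
     (if own i t1 t2
      then prefixed (One q i) (Strat t1 t2 (push_path (One q i) \<chi>))
      else Strat t1 t2 (push_path (One q i) \<chi>))"
| "push (Two q i q' j) (Strat t1 t2 \<chi>) =
     (if own i t1 t2 \<and> own j t1 t2
      then prefixed (Two q i q' j) (Strat t1 t2 (push_path (Two q i q' j) \<chi>))
      else if own i t1 t2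
      then Quant q i (Strat t1 t2 (push_path (Two q i q' j) \<chi>))
      else if own j t1 t2
      then Quant q' j (Strat t1 t2 (push_path (Two q i q' j) \<chi>))
      else Strat t1 t2 (push_path (Two q i q' j) \<chi>))"
| "push (One q i) (Quant r k \<psi>) =
     (if i = k then push (One r k) \<psi> else push (Two q i r k) \<psi>)"
| "push (Two q i q' j) (Quant r k \<psi>) =
     (if i = k then push (Two q' j r k) \<psi> else push (Two q i r k) \<psi>)"
| "push_path Q (Next \<psi>) = Next (push Q \<psi>)"
| "push_path Q (Always \<psi>) = Always (push Q \<psi>)"
| "push_path Q (Until \<psi>1 \<psi>2) = Until (push Q \<psi>1) (push Q \<psi>2)"

end

theory Submission imports Defs begin

text \<open>
  Idle agents do not influence the guards, so additional agents can only help the side they join;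
  hence a formula in which all free occurrences of \<open>y\<^sub>i\<close> have the same parity is monotone
  in \<open>y\<^sub>i\<close>. A quantifier over a monotone predicate evaluates it either at \<open>0\<close> or
  at all sufficiently large numbers, that is, along a proper filter. Because the state space is
  finite, along that filter every state formula takes its quantified value at all states
  simultaneously, so it may be replaced by its quantified version below a strategic operator.
\<close>

section \<open>Monotonicity\<close>

text \<open>The objective is abstracted to a predicate on state sequences, so that agent numbers and
  objective can be varied together when a formula is compared at two assignments.\<close>

definition wins ::
    "('ag, 's, 'p) hdmas \<Rightarrow> nat \<Rightarrow> nat \<Rightarrow> 's \<Rightarrow> ((nat \<Rightarrow> 's) \<Rightarrow> bool) \<Rightarrow> bool" where
  "wins M c n s P \<longleftrightarrow> (\<exists>\<sigma>. joint_strategy M c \<sigma> \<and> (\<forall>\<pi>. play M \<sigma> n s \<pi> \<longrightarrow> P \<pi>))"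

lemma sat_Strat: "sat M s \<theta> (Strat t1 t2 \<chi>) \<longleftrightarrow>
    wins M (\<theta> t1) (\<theta> t2) s (\<lambda>\<pi>. path_sat M \<pi> \<theta> \<chi>)"
  by (simp add: wins_def)

section \<open>Surplus agents kept idle\<close>

lemma pval_Idle: "(\<And>i. f (Act i) = g (Act i)) \<Longrightarrow> pval f t = pval g t"
  by (induction t) auto

text \<open>Terms have no counter for \<open>Idle\<close>, so a guard cannot see how many agents
  idle.\<close>

lemma guard_sat_Idle: "(\<And>i. f (Act i) = g (Act i)) \<Longrightarrow> guard_sat f \<gamma> = guard_sat g \<gamma>"
  by (induction \<gamma>) (simp_all add: pval_Idle[of f g])

text \<open>Since \<open>Idle\<close> is available in every state, the \<open>c' - c\<close>
  additional agents can all be placed there.\<close>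

lemma distribution_add_Idle:
  assumes "is_hdmas M" "s \<in> states M" "distribution M s c f" "c \<le> c'"
  shows "distribution M s c' (f(Idle := f Idle + (c' - c)))"
proof -
  have "Idle \<in> avail M s" "avail M s \<subseteq> actions M"
    using assms(1,2) unfolding is_hdmas_def by auto
  \<comment> \<open>A sum over an infinite set defaults to 0, so finiteness is secured through the
    finite set \<open>actions M\<close>.\<close>
  then have fin: "finite (avail M s)"
    by (auto simp: actions_def intro: finite_subset)
  have "(\<Sum>a\<in>avail M s. (f(Idle := f Idle + (c' - c))) a) = (\<Sum>a\<in>avail M s. f a) + (c' - c)"
    using fin \<open>Idle \<in> avail M s\<close> by (simp add: sum.remove)
  then show ?thesis
    using assms(3,4) \<open>Idle \<in> avail M s\<close> by (auto simp: distribution_def profile_def)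
qed

lemma play_states: "play M \<sigma> n s \<pi> \<Longrightarrow> s \<in> states M \<Longrightarrow> \<pi> k \<in> states M"
  by (cases k) (auto simp: play_def)

text \<open>The surplus opponents idle and the two strategies agree on all proper actions, so the
  guards along \<open>\<pi>\<close> stay true.\<close>

lemma play_mono:
  assumes M: "is_hdmas M" and s: "s \<in> states M" and p: "play M \<sigma> n s \<pi>" and "n \<le> n'"
    and \<sigma>: "\<And>s i. s \<in> states M \<Longrightarrow> \<sigma> s (Act i) = \<sigma>' s (Act i)"
  shows "play M \<sigma>' n' s \<pi>"
  unfolding play_def
proof (intro conjI allI)
  show "\<pi> 0 = s" using p by (simp add: play_def)
  fix k
  obtain g where g: "distribution M (\<pi> k) n g" "\<pi> (Suc k) \<in> states M"
      "guard_sat (\<lambda>a. \<sigma> (\<pi> k) a + g a) (guard_of M (\<pi> k) (\<pi> (Suc k)))"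
    using p unfolding play_def by blast
  let ?g = "g(Idle := g Idle + (n' - n))"
  have k: "\<pi> k \<in> states M" using play_states p s by metis
  have "guard_sat (\<lambda>a. \<sigma>' (\<pi> k) a + ?g a) (guard_of M (\<pi> k) (\<pi> (Suc k)))"
    using g(3) \<sigma>[OF k]
    by (subst guard_sat_Idle[where g = "\<lambda>a. \<sigma> (\<pi> k) a + g a"]) auto
  then show "\<exists>g. distribution M (\<pi> k) n' g \<and> \<pi> (Suc k) \<in> states M \<and>
      guard_sat (\<lambda>a. \<sigma>' (\<pi> k) a + g a) (guard_of M (\<pi> k) (\<pi> (Suc k)))"
    using distribution_add_Idle[OF M k g(1) \<open>n \<le> n'\<close>] g(2) by blast
qed

text \<open>The new own agents idle, and each play against \<open>n'\<close> opponents is also a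
  play of the original strategy against \<open>n\<close>. Objectives are compared only on sequences
  inside \<open>states M\<close>, where facts about states are available.\<close>

lemma wins_mono:
  assumes M: "is_hdmas M" and s: "s \<in> states M" and w: "wins M c n s P"
    and "c \<le> c'" "n' \<le> n" and P: "\<And>\<pi>. range \<pi> \<subseteq> states M \<Longrightarrow> P \<pi> \<Longrightarrow> P' \<pi>"
  shows "wins M c' n' s P'"
proof -
  obtain \<sigma> where \<sigma>: "joint_strategy M c \<sigma>" "\<And>\<pi>. play M \<sigma> n s \<pi> \<Longrightarrow> P \<pi>"
    using w unfolding wins_def by blast
  define \<sigma>' where "\<sigma>' s = (\<sigma> s)(Idle := \<sigma> s Idle + (c' - c))" for s
  have "joint_strategy M c' \<sigma>'"
    using \<sigma>(1) distribution_add_Idle[OF M _ _ \<open>c \<le> c'\<close>]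
    by (auto simp: joint_strategy_def \<sigma>'_def)
  moreover have "P' \<pi>" if \<pi>: "play M \<sigma>' n' s \<pi>" for \<pi>
  proof (rule P)
    show "range \<pi> \<subseteq> states M" using play_states[OF \<pi> s] by blast
    show "P \<pi>"
      by (rule \<sigma>(2)[OF play_mono[OF M s \<pi> \<open>n' \<le> n\<close>]]) (simp add: \<sigma>'_def)
  qed
  ultimately show ?thesis unfolding wins_def by blast
qed

lemma wins_cong:
  assumes "is_hdmas M" "s \<in> states M" "\<And>\<pi>. range \<pi> \<subseteq> states M \<Longrightarrow> P \<pi> = P' \<pi>"
  shows "wins M c n s P = wins M c n s P'"
  using wins_mono[OF assms(1,2), of c n _ c n] assms(3) by blast

section \<open>Monotonicity of formulas in the agent numbers\<close>

definition mono_in :: "bool \<Rightarrow> yvar \<Rightarrow> ((tm \<Rightarrow> nat) \<Rightarrow> bool) \<Rightarrow> bool" where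
  "mono_in d y R \<longleftrightarrow> (\<forall>\<theta> m n. m \<le> n \<longrightarrow>
     (if d then R (\<theta>(YVar y := m)) \<longrightarrow> R (\<theta>(YVar y := n))
      else R (\<theta>(YVar y := n)) \<longrightarrow> R (\<theta>(YVar y := m))))"

text \<open>
  Positive occurrences of \<open>y\<^sub>1\<close> make a formula increasing, those of \<open>y\<^sub>2\<close> decreasing.
\<close>

definition aligned :: "bool \<Rightarrow> yvar \<Rightarrow> nat set \<Rightarrow> bool" where
  "aligned d y N \<longleftrightarrow> (\<forall>n\<in>N. even n = (d = (y = Y1)))"

lemma aligned_simps [simp]:
  "aligned d y {}"
  "aligned d y (A \<union> B) \<longleftrightarrow> aligned d y A \<and> aligned d y B"
  "aligned d y (Suc ` A) \<longleftrightarrow> aligned (\<not> d) y A"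
  "aligned d y (insert 0 A) \<longleftrightarrow> d = (y = Y1) \<and> aligned d y A"
  by (auto simp: aligned_def)

lemma aligned_positive: "positive_in y \<phi> \<Longrightarrow> aligned (y = Y1) y (neg_depths y \<phi>)"
  by (simp add: positive_in_def aligned_def)

lemma mono_in_const: "(\<And>\<theta> n. R (\<theta>(YVar y := n)) = R \<theta>) \<Longrightarrow> mono_in d y R"
  by (simp add: mono_in_def)

lemma mono_in_upd: "mono_in d y R \<Longrightarrow> x \<noteq> y \<Longrightarrow> mono_in d y (\<lambda>\<theta>. R (\<theta>(YVar x := n)))"
  unfolding mono_in_def by (metis fun_upd_twist tm.inject(1))

lemma mono_in_all: "(\<And>i. mono_in d y (R i)) \<Longrightarrow> mono_in d y (\<lambda>\<theta>. \<forall>i. R i \<theta>)"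
  unfolding mono_in_def by (smt (verit))

lemma mono_in_ex: "(\<And>i. mono_in d y (R i)) \<Longrightarrow> mono_in d y (\<lambda>\<theta>. \<exists>i. R i \<theta>)"
  unfolding mono_in_def by (smt (verit))

lemma mono_in_conj:
  "mono_in d y R \<Longrightarrow> mono_in d y R' \<Longrightarrow> mono_in d y (\<lambda>\<theta>. R \<theta> \<and> R' \<theta>)"
  unfolding mono_in_def by (smt (verit))

lemma mono_in_disj:
  "mono_in d y R \<Longrightarrow> mono_in d y R' \<Longrightarrow> mono_in d y (\<lambda>\<theta>. R \<theta> \<or> R' \<theta>)"
  unfolding mono_in_def by (smt (verit))

lemma mono_in_imp: "mono_in d y R \<Longrightarrow> mono_in d y (\<lambda>\<theta>. A \<longrightarrow> R \<theta>)"
  unfolding mono_in_def by (smt (verit))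

lemma mono_in_neg: "mono_in (\<not> d) y R \<Longrightarrow> mono_in d y (\<lambda>\<theta>. \<not> R \<theta>)"
  unfolding mono_in_def by (smt (verit))

text \<open>More own agents or fewer opponents only help. The syntax confines
  \<open>y\<^sub>1\<close> to \<open>t1\<close> and \<open>y\<^sub>2\<close> to \<open>t2\<close>,
  so moving \<open>y\<close> in direction \<open>d\<close> never harms the coalition, and the
  objective only becomes easier.\<close>

lemma mono_in_Strat:
  assumes M: "is_hdmas M" and s: "s \<in> states M"
    and t: "t1 \<noteq> YVar Y2" "t2 \<noteq> YVar Y1"
    and d: "t1 = YVar y \<or> t2 = YVar y \<Longrightarrow> d = (y = Y1)"
    and \<chi>: "\<And>\<pi>. range \<pi> \<subseteq> states M \<Longrightarrow> mono_in d y (\<lambda>\<theta>. path_sat M \<pi> \<theta> \<chi>)"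
  shows "mono_in d y (\<lambda>\<theta>. sat M s \<theta> (Strat t1 t2 \<chi>))"
proof -
  \<comment> \<open>Orienting the order of \<open>m\<close> and \<open>n\<close> by \<open>d\<close>
    treats the increasing and the decreasing case at once.\<close>
  have up: "sat M s (\<theta>(YVar y := m)) (Strat t1 t2 \<chi>) \<Longrightarrow> sat M s (\<theta>(YVar y := n)) (Strat t1 t2 \<chi>)"
    if "if d then m \<le> n else n \<le> m" for \<theta> m n
    unfolding sat_Strat
  proof (erule wins_mono[OF M s])
    show "(\<theta>(YVar y := m)) t1 \<le> (\<theta>(YVar y := n)) t1"
      using that t d by (cases y) auto
    show "(\<theta>(YVar y := n)) t2 \<le> (\<theta>(YVar y := m)) t2"
      using that t d by (cases y) auto
    show "path_sat M \<pi> (\<theta>(YVar y := n)) \<chi>"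
      if "range \<pi> \<subseteq> states M" "path_sat M \<pi> (\<theta>(YVar y := m)) \<chi>" for \<pi>
      using \<chi>[OF that(1)] that(2) \<open>if d then m \<le> n else n \<le> m\<close>
      unfolding mono_in_def by (metis (full_types))
  qed
  show ?thesis unfolding mono_in_def using up by (simp del: sat.simps)
qed

text \<open>The direction \<open>d\<close> is generalised in the induction because a negation
  reverses it. A quantifier that rebinds \<open>y\<close> overwrites its value and leaves a
  constant.\<close>

lemma mono_in_sat:
  fixes \<phi> :: "'p sform" and \<chi> :: "'p pform"
  assumes M: "is_hdmas M"
  shows "state_formula \<phi> \<Longrightarrow> aligned d y (neg_depths y \<phi>) \<Longrightarrow> s \<in> states M \<Longrightarrow>
      mono_in d y (\<lambda>\<theta>. sat M s \<theta> \<phi>)"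
    and "path_formula \<chi> \<Longrightarrow> aligned d y (path_neg_depths y \<chi>) \<Longrightarrow> range \<pi> \<subseteq> states M \<Longrightarrow>
      mono_in d y (\<lambda>\<theta>. path_sat M \<pi> \<theta> \<chi>)"
proof (induction \<phi> and \<chi> arbitrary: d s and d \<pi>)
  case (Strat t1 t2 \<chi>)
  have "path_formula \<chi>" "aligned d y (path_neg_depths y \<chi>)"
    using Strat.prems by auto
  with Strat show ?case
    by (intro mono_in_Strat[OF M]) (auto split: if_splits)
next
  case (Quant q x \<phi>)
  show ?case
  proof (cases "x = y")
    case True
    then show ?thesis by (cases q) (simp_all add: mono_in_def)
  next
    case False
    then have "mono_in d y (\<lambda>\<theta>. sat M s (\<theta>(YVar x := n)) \<phi>)" for n
      using Quant by (intro mono_in_upd) auto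
    then show ?thesis by (cases q) (auto intro: mono_in_all mono_in_ex)
  qed
next
  case (Always \<phi>)
  then show ?case by (auto simp: image_subset_iff intro!: mono_in_all)
next
  case (Until \<psi> \<phi>)
  then have "mono_in d y (\<lambda>\<theta>. sat M (\<pi> k) \<theta> \<phi>)" "mono_in d y (\<lambda>\<theta>. sat M (\<pi> k) \<theta> \<psi>)" for k
    by (auto simp: image_subset_iff)
  then show ?case by (auto intro!: mono_in_ex mono_in_conj mono_in_all mono_in_imp)
next
  case (Neg \<phi>)
  then show ?case by (auto intro: mono_in_neg)
next
  case (Conj \<phi> \<psi>)
  then show ?case by (auto intro: mono_in_conj)
next
  case (Disj \<phi> \<psi>)
  then show ?case by (auto intro: mono_in_disj)
next
  case (Next \<phi>)
  then show ?case by (simp add: image_subset_iff)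
qed (simp_all add: mono_in_const)

section \<open>Quantifiers as limits\<close>

definition quantify :: "quant \<Rightarrow> (nat \<Rightarrow> bool) \<Rightarrow> bool" where
  "quantify q P = (case q of Forall \<Rightarrow> \<forall>n. P n | Exists \<Rightarrow> \<exists>n. P n)"

text \<open>The end of the number line that decides the quantifier: infinity for an existential over
  an increasing or a universal over a decreasing predicate, and 0 otherwise.\<close>

definition quant_filter :: "quant \<Rightarrow> bool \<Rightarrow> nat filter" where
  "quant_filter q d = (if d = (q = Exists) then at_top else principal {0})"

lemma quantify_const [simp]: "quantify q (\<lambda>_. P) = P"
  by (cases q) (auto simp: quantify_def)

lemma quant_filter_not_bot: "quant_filter q d \<noteq> bot"
  by (auto simp: quant_filter_def principal_eq_bot_iff)

lemma eventually_quantify: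
  assumes "\<And>m n. m \<le> n \<Longrightarrow> if d then P m \<longrightarrow> P n else P n \<longrightarrow> P m"
  shows "eventually (\<lambda>n. P n = quantify q P) (quant_filter q d)"
proof (cases "d = (q = Exists)")
  case False
  \<comment> \<open>Here 0 is the hardest argument for a universal and the easiest for an
    existential quantifier.\<close>
  have "P 0 = quantify q P"
  proof (cases q)
    case Forall
    then have "P 0 \<longrightarrow> P n" for n
      using assms[of 0 n] False by simp
    then show ?thesis using Forall by (auto simp: quantify_def)
  next
    case Exists
    then have "P n \<longrightarrow> P 0" for n
      using assms[of 0 n] False by simp
    then show ?thesis using Exists by (auto simp: quantify_def)
  qed
  then show ?thesis
    using False by (simp add: quant_filter_def eventually_principal)
next
  case True
  \<comment> \<open>A monotone sequence of truth values stabilises: \<open>N\<close> can be a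
    counterexample (universal) or a witness (existential), and is arbitrary if there is
    none.\<close>
  have "\<exists>N. \<forall>n\<ge>N. P n = quantify q P"
  proof (cases q)
    case Forall
    then have "P n \<longrightarrow> P m" if "m \<le> n" for m n
      using assms[OF that] True by simp
    then show ?thesis using Forall by (simp add: quantify_def) blast
  next
    case Exists
    then have "P m \<longrightarrow> P n" if "m \<le> n" for m n
      using assms[OF that] True by simp
    then show ?thesis using Exists by (simp add: quantify_def) blast
  qed
  then show ?thesis
    using True by (simp add: quant_filter_def eventually_at_top_linorder)
qed

section \<open>Iterated limits along quantifier prefixes\<close>

primrec pfx_vars :: "pfx \<Rightarrow> yvar set" where
  "pfx_vars (One q i) = {i}"
| "pfx_vars (Two q i q' j) = {i, j}"

primrec pquantify :: "pfx \<Rightarrow> (tm \<Rightarrow> nat) \<Rightarrow> ((tm \<Rightarrow> nat) \<Rightarrow> bool) \<Rightarrow> bool" where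
  "pquantify (One q i) \<theta> R = quantify q (\<lambda>n. R (\<theta>(YVar i := n)))"
| "pquantify (Two q i q' j) \<theta> R =
     quantify q (\<lambda>n. quantify q' (\<lambda>m. R (\<theta>(YVar i := n, YVar j := m))))"

text \<open>The filters are nested rather than multiplied, so the threshold for the second variable
  may depend on the value of the first.\<close>

primrec peventually ::
    "(yvar \<Rightarrow> bool) \<Rightarrow> pfx \<Rightarrow> (tm \<Rightarrow> nat) \<Rightarrow> ((tm \<Rightarrow> nat) \<Rightarrow> bool) \<Rightarrow> bool" where
  "peventually d (One q i) \<theta> R =
     eventually (\<lambda>n. R (\<theta>(YVar i := n))) (quant_filter q (d i))"
| "peventually d (Two q i q' j) \<theta> R =
     eventually (\<lambda>n. eventually (\<lambda>m. R (\<theta>(YVar i := n, YVar j := m)))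
       (quant_filter q' (d j))) (quant_filter q (d i))"

lemma sat_Quant: "sat M s \<theta> (Quant q y \<phi>) = quantify q (\<lambda>n. sat M s (\<theta>(YVar y := n)) \<phi>)"
  by (simp add: quantify_def)

lemma sat_prefixed: "sat M s \<theta> (prefixed Q \<phi>) = pquantify Q \<theta> (\<lambda>\<theta>. sat M s \<theta> \<phi>)"
  by (cases Q) (simp_all add: sat_Quant del: sat.simps)

lemma pquantify_upd:
  assumes "y \<in> pfx_vars Q"
  shows "pquantify Q (\<theta>(YVar y := k)) R = pquantify Q \<theta> R"
proof (cases Q)
  case (Two q i q' j)
  have "\<theta>(YVar y := k, YVar i := n, YVar j := m) = \<theta>(YVar i := n, YVar j := m)" for n m
    using assms Two by auto
  then show ?thesis by (simp add: Two)
qed (use assms in simp)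

lemma pquantify_neg: "pquantify Q \<theta> (\<lambda>\<theta>. \<not> R \<theta>) \<longleftrightarrow> \<not> pquantify (dual Q) \<theta> R"
proof -
  have "quantify q (\<lambda>n. \<not> P n) \<longleftrightarrow> \<not> quantify (dual_quant q) P" for q P
    by (cases q) (auto simp: quantify_def)
  then show ?thesis by (cases Q) simp_all
qed

lemma peventually_mono:
  "peventually d Q \<theta> R \<Longrightarrow> (\<And>\<theta>. R \<theta> \<Longrightarrow> R' \<theta>) \<Longrightarrow> peventually d Q \<theta> R'"
  by (cases Q) (auto elim!: eventually_mono)

lemma peventually_conj:
  "peventually d Q \<theta> R \<Longrightarrow> peventually d Q \<theta> R' \<Longrightarrow> peventually d Q \<theta> (\<lambda>\<theta>. R \<theta> \<and> R' \<theta>)"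
  by (cases Q) (simp_all add: eventually_conj_iff)

text \<open>Filters are closed under finite intersections only; this is where a finite state space
  matters.\<close>

lemma peventually_ball_finite:
  assumes "finite S" "\<And>s. s \<in> S \<Longrightarrow> peventually d Q \<theta> (R s)"
  shows "peventually d Q \<theta> (\<lambda>\<theta>. \<forall>s\<in>S. R s \<theta>)"
  using assms by (cases Q) (simp_all add: eventually_ball_finite_distrib)

text \<open>Properness of the filters yields a concrete assignment. It differs from
  \<open>\<theta>\<close> only in prefix variables, which \<open>pquantify\<close> overwrites
  anyway.\<close>

lemma peventually_ex:
  assumes "peventually d Q \<theta> R"
  obtains \<theta>' where "R \<theta>'" "\<And>R. pquantify Q \<theta>' R = pquantify Q \<theta> R"
proof (cases Q)
  case (One q i)
  with assms obtain n where "R (\<theta>(YVar i := n))"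
    using eventually_happens' quant_filter_not_bot by fastforce
  then show ?thesis
    using that One pquantify_upd[of i Q] by simp
next
  case (Two q i q' j)
  with assms obtain n where "eventually (\<lambda>m. R (\<theta>(YVar i := n, YVar j := m)))
      (quant_filter q' (d j))"
    using eventually_happens' quant_filter_not_bot by fastforce
  then obtain m where m: "R (\<theta>(YVar i := n, YVar j := m))"
    using eventually_happens' quant_filter_not_bot by blast
  have "pquantify Q (\<theta>(YVar i := n, YVar j := m)) R = pquantify Q \<theta> R" for R
    unfolding Two by (simp add: pquantify_upd del: pquantify.simps)
  with m show ?thesis using that by blast
qed

text \<open>Quantifying over \<open>j\<close> preserves monotonicity in \<open>i\<close>, so
  \<open>eventually_quantify\<close> applies first to the outer variable and then, for each fixed
  outer value, to the inner one.\<close>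

lemma peventually_pquantify:
  assumes "admissible Q" "\<And>y. y \<in> pfx_vars Q \<Longrightarrow> mono_in (d y) y R"
  shows "peventually d Q \<theta> (\<lambda>\<theta>. R \<theta> = pquantify Q \<theta> R)"
proof (cases Q)
  case (One q i)
  then show ?thesis
    using assms(2)[of i]
    by (auto simp: mono_in_def intro!: eventually_quantify)
next
  case (Two q i q' j)
  with assms(1) have ij: "i \<noteq> j" by simp
  let ?R = "\<lambda>\<theta>. quantify q' (\<lambda>m. R (\<theta>(YVar j := m)))"
  have "mono_in (d i) i (\<lambda>\<theta>. R (\<theta>(YVar j := m)))" for m
    using assms(2)[of i] Two ij by (intro mono_in_upd) auto
  then have mono: "mono_in (d i) i ?R"
    unfolding quantify_def by (cases q') (auto intro: mono_in_all mono_in_ex)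
  have outer: "eventually (\<lambda>n. ?R (\<theta>(YVar i := n)) = quantify q (\<lambda>n. ?R (\<theta>(YVar i := n))))
      (quant_filter q (d i))"
    using mono by (intro eventually_quantify) (auto simp: mono_in_def)
  have inner: "eventually (\<lambda>m. R (\<theta>(YVar j := m)) = ?R \<theta>) (quant_filter q' (d j))" for \<theta>
    using assms(2)[of j] Two by (intro eventually_quantify) (auto simp: mono_in_def)
  \<comment> \<open>The quantified value is first taken at the original assignment; invariance under
    updates of prefix variables then moves it to the updated one.\<close>
  have "peventually d Q \<theta> (\<lambda>\<theta>'. R \<theta>' = pquantify Q \<theta> R)"
    unfolding Two peventually.simps pquantify.simps
    using outer
  proof eventually_elim
    case (elim n)
    show ?case using inner[of "\<theta>(YVar i := n)"] elim by simp
  qed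
  moreover have "pquantify Q (\<theta>(YVar i := n, YVar j := m)) R = pquantify Q \<theta> R" for n m
    unfolding Two by (simp add: pquantify_upd del: pquantify.simps)
  ultimately show ?thesis by (simp add: Two)
qed

text \<open>Both predicates eventually equal their quantified values, so one assignment at which all
  these facts hold identifies the two values.\<close>

lemma pquantify_cong:
  assumes "admissible Q"
    and "\<And>y. y \<in> pfx_vars Q \<Longrightarrow> mono_in (d y) y R"
    and "\<And>y. y \<in> pfx_vars Q \<Longrightarrow> mono_in (d y) y R'"
    and "peventually d Q \<theta> (\<lambda>\<theta>. R \<theta> = R' \<theta>)"
  shows "pquantify Q \<theta> R = pquantify Q \<theta> R'"
proof -
  have "peventually d Q \<theta> (\<lambda>\<theta>. R \<theta> = pquantify Q \<theta> R \<and> R' \<theta> = pquantify Q \<theta> R' \<and> R \<theta> = R' \<theta>)"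
    using assms by (intro peventually_conj peventually_pquantify)
  then show ?thesis by (rule peventually_ex) metis
qed

text \<open>An existential does not distribute over conjunction in general. Here both conjuncts
  share the directions \<open>d\<close>, hence the same filters, and all three values are read off
  at one assignment.\<close>

lemma pquantify_conj:
  assumes "admissible Q"
    and "\<And>y. y \<in> pfx_vars Q \<Longrightarrow> mono_in (d y) y R"
    and "\<And>y. y \<in> pfx_vars Q \<Longrightarrow> mono_in (d y) y R'"
  shows "pquantify Q \<theta> (\<lambda>\<theta>. R \<theta> \<and> R' \<theta>) \<longleftrightarrow> pquantify Q \<theta> R \<and> pquantify Q \<theta> R'"
proof -
  have "peventually d Q \<theta> (\<lambda>\<theta>. R \<theta> = pquantify Q \<theta> R \<and> R' \<theta> = pquantify Q \<theta> R' \<and>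
      (R \<theta> \<and> R' \<theta>) = pquantify Q \<theta> (\<lambda>\<theta>. R \<theta> \<and> R' \<theta>))"
    using assms by (intro peventually_conj peventually_pquantify mono_in_conj)
  then show ?thesis by (rule peventually_ex) metis
qed

lemma pquantify_disj:
  assumes "admissible Q"
    and "\<And>y. y \<in> pfx_vars Q \<Longrightarrow> mono_in (d y) y R"
    and "\<And>y. y \<in> pfx_vars Q \<Longrightarrow> mono_in (d y) y R'"
  shows "pquantify Q \<theta> (\<lambda>\<theta>. R \<theta> \<or> R' \<theta>) \<longleftrightarrow> pquantify Q \<theta> R \<or> pquantify Q \<theta> R'"
proof -
  have "peventually d Q \<theta> (\<lambda>\<theta>. R \<theta> = pquantify Q \<theta> R \<and> R' \<theta> = pquantify Q \<theta> R' \<and>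
      (R \<theta> \<or> R' \<theta>) = pquantify Q \<theta> (\<lambda>\<theta>. R \<theta> \<or> R' \<theta>))"
    using assms by (intro peventually_conj peventually_pquantify mono_in_disj)
  then show ?thesis by (rule peventually_ex) metis
qed

section \<open>Correctness of pushing\<close>

lemma own_iff: "t1 \<noteq> YVar Y2 \<Longrightarrow> t2 \<noteq> YVar Y1 \<Longrightarrow> own y t1 t2 \<longleftrightarrow> t1 = YVar y \<or> t2 = YVar y"
  by (cases y) auto

text \<open>The induction claim for path formulas. A single assignment must serve all sequences at
  once, since the strategy is fixed before the play; and pushing must remove all dependence on the
  prefix variables.\<close>

definition push_ok ::
    "('ag, 's, 'p) hdmas \<Rightarrow> (yvar \<Rightarrow> bool) \<Rightarrow> pfx \<Rightarrow> (tm \<Rightarrow> nat) \<Rightarrow> 'p pform \<Rightarrow> bool" where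
  "push_ok M d Q \<theta> \<chi> \<longleftrightarrow>
     peventually d Q \<theta> (\<lambda>\<theta>. \<forall>\<pi>. range \<pi> \<subseteq> states M \<longrightarrow>
       path_sat M \<pi> \<theta> (push_path Q \<chi>) = path_sat M \<pi> \<theta> \<chi>) \<and>
     (\<forall>\<pi> y n. range \<pi> \<subseteq> states M \<longrightarrow> y \<in> pfx_vars Q \<longrightarrow>
       path_sat M \<pi> (\<theta>(YVar y := n)) (push_path Q \<chi>) = path_sat M \<pi> \<theta> (push_path Q \<chi>))"

lemma peventually_push:
  assumes M: "is_hdmas M" "finite (states M)" and "admissible Q" "state_formula \<phi>"
    and "\<And>y. y \<in> pfx_vars Q \<Longrightarrow> aligned (d y) y (neg_depths y \<phi>)"
    and push: "\<And>s \<theta>. s \<in> states M \<Longrightarrow>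
      sat M s \<theta> (push Q \<phi>) = pquantify Q \<theta> (\<lambda>\<theta>. sat M s \<theta> \<phi>)"
  shows "peventually d Q \<theta> (\<lambda>\<theta>. \<forall>s\<in>states M. sat M s \<theta> (push Q \<phi>) = sat M s \<theta> \<phi>)"
proof (rule peventually_ball_finite[OF M(2)])
  fix s assume s: "s \<in> states M"
  have "peventually d Q \<theta> (\<lambda>\<theta>. sat M s \<theta> \<phi> = pquantify Q \<theta> (\<lambda>\<theta>. sat M s \<theta> \<phi>))"
    using assms s by (intro peventually_pquantify mono_in_sat)
  then show "peventually d Q \<theta> (\<lambda>\<theta>. sat M s \<theta> (push Q \<phi>) = sat M s \<theta> \<phi>)"
    by (simp add: push[OF s] eq_commute)
qed

text \<open>Eventually the pushed and the original objective agree on all relevant sequences, so the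
  same strategies win; \<open>pquantify_cong\<close> turns this into equality of the quantified
  values.\<close>

lemma pquantify_Strat_push:
  assumes M: "is_hdmas M" and Q: "admissible Q" and s: "s \<in> states M"
    and \<phi>: "state_formula (Strat t1 t2 \<chi>)"
    and d: "\<And>y. y \<in> pfx_vars Q \<Longrightarrow> aligned (d y) y (neg_depths y (Strat t1 t2 \<chi>))"
    and ok: "\<And>\<theta>. push_ok M d Q \<theta> \<chi>"
  shows "pquantify Q \<theta> (\<lambda>\<theta>. sat M s \<theta> (Strat t1 t2 \<chi>)) =
      pquantify Q \<theta> (\<lambda>\<theta>. sat M s \<theta> (Strat t1 t2 (push_path Q \<chi>)))"
proof (rule pquantify_cong[OF Q])
  show "mono_in (d y) y (\<lambda>\<theta>. sat M s \<theta> (Strat t1 t2 \<chi>))" if "y \<in> pfx_vars Q" for y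
    using mono_in_sat(1)[OF M \<phi> d[OF that] s] .
  show "mono_in (d y) y (\<lambda>\<theta>. sat M s \<theta> (Strat t1 t2 (push_path Q \<chi>)))" if y: "y \<in> pfx_vars Q" for y
  proof (rule mono_in_Strat[OF M s])
    show "t1 \<noteq> YVar Y2" "t2 \<noteq> YVar Y1" using \<phi> by auto
    show "d y = (y = Y1)" if "t1 = YVar y \<or> t2 = YVar y"
      using d[OF y] that by simp
    \<comment> \<open>By \<open>push_ok\<close> the pushed objective is constant in
      \<open>y\<close>.\<close>
    show "mono_in (d y) y (\<lambda>\<theta>. path_sat M \<pi> \<theta> (push_path Q \<chi>))"
      if "range \<pi> \<subseteq> states M" for \<pi>
      using ok y that by (intro mono_in_const) (auto simp: push_ok_def)
  qed
  show "peventually d Q \<theta> (\<lambda>\<theta>. sat M s \<theta> (Strat t1 t2 \<chi>) = sat M s \<theta> (Strat t1 t2 (push_path Q \<chi>)))"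
    using ok[of \<theta>, unfolded push_ok_def, THEN conjunct1]
    by (rule peventually_mono) (unfold sat_Strat, rule wins_cong[OF M s], simp)
qed

lemma Strat_push_upd:
  assumes "is_hdmas M" "s \<in> states M" "state_formula (Strat t1 t2 \<chi>)"
    and "push_ok M d Q \<theta> \<chi>" "y \<in> pfx_vars Q" "\<not> own y t1 t2"
  shows "sat M s (\<theta>(YVar y := n)) (Strat t1 t2 (push_path Q \<chi>)) =
      sat M s \<theta> (Strat t1 t2 (push_path Q \<chi>))"
proof -
  have "t1 \<noteq> YVar y" "t2 \<noteq> YVar y" using assms(3,6) own_iff by auto
  then show ?thesis
    using assms(4,5) unfolding sat_Strat push_ok_def
    by (simp, intro wins_cong[OF assms(1,2)]) simp
qed

text \<open>Induction along the recursion of \<open>push\<close>. Alignment with arbitrary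
  directions replaces positivity, which does not survive passing below a negation.\<close>

lemma sat_push:
  fixes \<phi> :: "'p sform" and \<chi> :: "'p pform" and M :: "('ag, 's, 'p) hdmas"
  assumes M: "is_hdmas M" "finite (states M)"
  shows "admissible Q \<Longrightarrow> state_formula \<phi> \<Longrightarrow>
      (\<And>y. y \<in> pfx_vars Q \<Longrightarrow> aligned (d y) y (neg_depths y \<phi>)) \<Longrightarrow> s \<in> states M \<Longrightarrow>
      sat M s \<theta> (push Q \<phi>) = pquantify Q \<theta> (\<lambda>\<theta>. sat M s \<theta> \<phi>)"
    and "admissible Q \<Longrightarrow> path_formula \<chi> \<Longrightarrow>
      (\<And>y. y \<in> pfx_vars Q \<Longrightarrow> aligned (d y) y (path_neg_depths y \<chi>)) \<Longrightarrow>
      push_ok M d Q \<theta> \<chi>"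
proof (induction Q \<phi> and Q \<chi> arbitrary: d s \<theta> and d \<theta> rule: push_push_path.induct)
  case (1 Q)
  then show ?case by (cases Q) simp_all
next
  case (2 Q p)
  then show ?case by (cases Q) simp_all
next
  case (3 Q \<psi>)
  have "pfx_vars (dual Q) = pfx_vars Q" "admissible (dual Q) = admissible Q"
    by (cases Q; simp)+
  \<comment> \<open>Dualising the prefix goes with reversing every direction.\<close>
  with 3 show ?case
    using "3.IH"[of "\<lambda>y. \<not> d y" s \<theta>] by (simp add: pquantify_neg)
next
  case (4 Q \<phi> \<psi>)
  have mono: "mono_in (d y) y (\<lambda>\<theta>. sat M s \<theta> \<phi>)" "mono_in (d y) y (\<lambda>\<theta>. sat M s \<theta> \<psi>)"
    if "y \<in> pfx_vars Q" for y
    using "4.prems" that by (auto intro!: mono_in_sat M)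
  have "sat M s \<theta> (push Q \<phi>) = pquantify Q \<theta> (\<lambda>\<theta>. sat M s \<theta> \<phi>)"
    using "4.prems" by (intro "4.IH"(1)[of d]) auto
  moreover have "sat M s \<theta> (push Q \<psi>) = pquantify Q \<theta> (\<lambda>\<theta>. sat M s \<theta> \<psi>)"
    using "4.prems" by (intro "4.IH"(2)[of d]) auto
  ultimately show ?case
    by (simp add: pquantify_conj[where d = d, OF "4.prems"(1) mono])
next
  case (5 Q \<phi> \<psi>)
  have mono: "mono_in (d y) y (\<lambda>\<theta>. sat M s \<theta> \<phi>)" "mono_in (d y) y (\<lambda>\<theta>. sat M s \<theta> \<psi>)"
    if "y \<in> pfx_vars Q" for y
    using "5.prems" that by (auto intro!: mono_in_sat M)
  have "sat M s \<theta> (push Q \<phi>) = pquantify Q \<theta> (\<lambda>\<theta>. sat M s \<theta> \<phi>)"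
    using "5.prems" by (intro "5.IH"(1)[of d]) auto
  moreover have "sat M s \<theta> (push Q \<psi>) = pquantify Q \<theta> (\<lambda>\<theta>. sat M s \<theta> \<psi>)"
    using "5.prems" by (intro "5.IH"(2)[of d]) auto
  ultimately show ?case
    by (simp add: pquantify_disj[where d = d, OF "5.prems"(1) mono])
next
  case (6 q i t1 t2 \<chi>)
  \<comment> \<open>Each branch of \<open>push\<close> has its own induction hypothesis, hence the
    split on \<open>own\<close>.\<close>
  have ok: "push_ok M d (One q i) \<theta> \<chi>" for \<theta>
  proof -
    have "path_formula \<chi>" using "6.prems"(2) by simp
    moreover have "aligned (d y) y (path_neg_depths y \<chi>)" if "y \<in> pfx_vars (One q i)" for y
      using "6.prems"(3)[OF that] by (simp split: if_splits)
    ultimately show ?thesis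
      using "6.IH"(1)[OF _ "6.prems"(1)] "6.IH"(2)[OF _ "6.prems"(1)]
      by (cases "own i t1 t2") blast+
  qed
  let ?S = "Strat t1 t2 (push_path (One q i) \<chi>)"
  have eq: "pquantify (One q i) \<theta> (\<lambda>\<theta>. sat M s \<theta> (Strat t1 t2 \<chi>)) =
      quantify q (\<lambda>n. sat M s (\<theta>(YVar i := n)) ?S)"
    using pquantify_Strat_push[OF M(1) "6.prems"(1,4,2,3) ok] by simp
  show ?case
  proof (cases "own i t1 t2")
    case True
    then show ?thesis unfolding eq by (simp add: sat_Quant del: sat.simps)
  next
    case False
    have "sat M s (\<theta>(YVar i := n)) ?S = sat M s \<theta> ?S" for n
      using Strat_push_upd[OF M(1) "6.prems"(4,2) ok] False by simp
    then show ?thesis unfolding eq using False by (simp del: sat.simps)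
  qed
next
  case (7 q i q' j t1 t2 \<chi>)
  have ok: "push_ok M d (Two q i q' j) \<theta> \<chi>" for \<theta>
  proof -
    have "path_formula \<chi>" using "7.prems"(2) by simp
    moreover have "aligned (d y) y (path_neg_depths y \<chi>)" if "y \<in> pfx_vars (Two q i q' j)" for y
      using "7.prems"(3)[OF that] by (simp split: if_splits)
    ultimately show ?thesis
      using "7.IH"(1)[OF _ "7.prems"(1)] "7.IH"(2)[OF _ _ "7.prems"(1)]
        "7.IH"(3)[OF _ _ _ "7.prems"(1)] "7.IH"(4)[OF _ _ _ "7.prems"(1)]
      by (cases "own i t1 t2"; cases "own j t1 t2") blast+
  qed
  let ?S = "Strat t1 t2 (push_path (Two q i q' j) \<chi>)"
  have eq: "pquantify (Two q i q' j) \<theta> (\<lambda>\<theta>. sat M s \<theta> (Strat t1 t2 \<chi>)) =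
      quantify q (\<lambda>n. quantify q' (\<lambda>m. sat M s (\<theta>(YVar i := n, YVar j := m)) ?S))"
    using pquantify_Strat_push[OF M(1) "7.prems"(1,4,2,3) ok] by simp
  have i: "sat M s (\<theta>(YVar i := n)) ?S = sat M s \<theta> ?S" if "\<not> own i t1 t2" for \<theta> n
    using Strat_push_upd[OF M(1) "7.prems"(4,2) ok] that by simp
  have j: "sat M s (\<theta>(YVar j := n)) ?S = sat M s \<theta> ?S" if "\<not> own j t1 t2" for \<theta> n
    using Strat_push_upd[OF M(1) "7.prems"(4,2) ok] that by simp
  \<comment> \<open>When only \<open>j\<close> is kept, swapping the updates puts the one of
    \<open>i\<close> last, where fact \<open>i\<close> erases it.\<close>
  have tw: "\<theta>(YVar i := n, YVar j := m) = \<theta>(YVar j := m, YVar i := n)" for n m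
    using "7.prems"(1) by auto
  consider "own i t1 t2" "own j t1 t2" | "own i t1 t2" "\<not> own j t1 t2"
    | "\<not> own i t1 t2" "own j t1 t2" | "\<not> own i t1 t2" "\<not> own j t1 t2" by blast
  then show ?case
  proof cases
    case 1
    then show ?thesis unfolding eq by (simp add: sat_Quant del: sat.simps)
  next
    case 2
    then show ?thesis unfolding eq by (simp add: sat_Quant j del: sat.simps)
  next
    case 3
    then show ?thesis unfolding eq tw by (simp add: sat_Quant i del: sat.simps)
  next
    case 4
    then show ?thesis unfolding eq by (simp add: i j del: sat.simps)
  qed
next
  case (8 q i r k \<psi>)
  \<comment> \<open>The quantifier binds \<open>k\<close>, so the direction of \<open>k\<close>
    inside \<open>\<psi>\<close> comes from the positivity condition on that quantifier and not from
    the outer \<open>d\<close>.\<close>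
  let ?d = "d(k := k = Y1)"
  have \<psi>: "state_formula \<psi>" "aligned (?d k) k (neg_depths k \<psi>)"
    using "8.prems"(2) by (auto simp: aligned_positive)
  show ?case
  proof (cases "i = k")
    case True
    have "sat M s \<theta> (push (One r k) \<psi>) = pquantify (One r k) \<theta> (\<lambda>\<theta>. sat M s \<theta> \<psi>)"
      using True \<psi> "8.prems"(4) by (intro "8.IH"(1)[of ?d]) auto
    then show ?thesis
      using True by (simp add: sat_Quant del: sat.simps)
  next
    case False
    have "sat M s \<theta> (push (Two q i r k) \<psi>) = pquantify (Two q i r k) \<theta> (\<lambda>\<theta>. sat M s \<theta> \<psi>)"
      using False \<psi> "8.prems"(3)[of i] "8.prems"(4) by (intro "8.IH"(2)[of ?d]) auto
    then show ?thesis
      using False by (simp add: sat_Quant del: sat.simps)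
  qed
next
  case (9 q i q' j r k \<psi>)
  let ?d = "d(k := k = Y1)"
  have \<psi>: "state_formula \<psi>" "aligned (?d k) k (neg_depths k \<psi>)"
    using "9.prems"(2) by (auto simp: aligned_positive)
  show ?case
  proof (cases "i = k")
    case True
    \<comment> \<open>The innermost quantifier rebinds \<open>i\<close>, so the outer value
      \<open>n\<close> is lost and its quantifier is vacuous.\<close>
    have tw: "\<theta>(YVar i := n, YVar j := m, YVar k := l) = \<theta>(YVar j := m, YVar k := l)" for n m l
      using True by auto
    have "sat M s \<theta> (push (Two q' j r k) \<psi>) = pquantify (Two q' j r k) \<theta> (\<lambda>\<theta>. sat M s \<theta> \<psi>)"
      using True \<psi> "9.prems"(1,4) "9.prems"(3)[of j] by (intro "9.IH"(1)[of ?d]) auto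
    then show ?thesis
      using True by (simp add: sat_Quant tw[unfolded True] del: sat.simps)
  next
    case False
    \<comment> \<open>There are only two variables, so \<open>k\<close> rebinds \<open>j\<close> and
      the quantifier \<open>q'\<close> becomes vacuous.\<close>
    have "j = k"
      using False "9.prems"(1) by (cases i; cases j; cases k) auto
    have "sat M s \<theta> (push (Two q i r k) \<psi>) = pquantify (Two q i r k) \<theta> (\<lambda>\<theta>. sat M s \<theta> \<psi>)"
      using False \<psi> "9.prems"(3)[of i] "9.prems"(4) by (intro "9.IH"(2)[of ?d]) auto
    then show ?thesis
      using False \<open>j = k\<close> by (simp add: sat_Quant del: sat.simps)
  qed
next
  case (10 Q \<psi>)
  have IH: "sat M s \<theta> (push Q \<psi>) = pquantify Q \<theta> (\<lambda>\<theta>. sat M s \<theta> \<psi>)" if "s \<in> states M" for s \<theta>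
    using "10.prems" that by (intro "10.IH"[of d]) auto
  have "peventually d Q \<theta> (\<lambda>\<theta>. \<forall>s\<in>states M. sat M s \<theta> (push Q \<psi>) = sat M s \<theta> \<psi>)"
    using "10.prems" by (intro peventually_push[OF M]) (auto simp: IH)
  \<comment> \<open>By \<open>IH\<close> a pushed state formula has the value of
    \<open>pquantify\<close>, which \<open>pquantify_upd\<close> shows to be independent of the
    prefix variables; this gives the second half of \<open>push_ok\<close>.\<close>
  then show ?case
    unfolding push_ok_def
    by (auto simp: IH pquantify_upd image_subset_iff elim!: peventually_mono)
next
  case (11 Q \<psi>)
  have IH: "sat M s \<theta> (push Q \<psi>) = pquantify Q \<theta> (\<lambda>\<theta>. sat M s \<theta> \<psi>)" if "s \<in> states M" for s \<theta>
    using "11.prems" that by (intro "11.IH"[of d]) auto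
  have "peventually d Q \<theta> (\<lambda>\<theta>. \<forall>s\<in>states M. sat M s \<theta> (push Q \<psi>) = sat M s \<theta> \<psi>)"
    using "11.prems" by (intro peventually_push[OF M]) (auto simp: IH)
  then show ?case
    unfolding push_ok_def
    by (auto simp: IH pquantify_upd image_subset_iff elim!: peventually_mono)
next
  case (12 Q \<psi> \<phi>)
  have IH: "sat M s \<theta> (push Q \<psi>) = pquantify Q \<theta> (\<lambda>\<theta>. sat M s \<theta> \<psi>)"
      "sat M s \<theta> (push Q \<phi>) = pquantify Q \<theta> (\<lambda>\<theta>. sat M s \<theta> \<phi>)" if "s \<in> states M" for s \<theta>
    using "12.prems" that by (intro "12.IH"[of d]; auto)+
  have "peventually d Q \<theta> (\<lambda>\<theta>. (\<forall>s\<in>states M. sat M s \<theta> (push Q \<psi>) = sat M s \<theta> \<psi>) \<and>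
      (\<forall>s\<in>states M. sat M s \<theta> (push Q \<phi>) = sat M s \<theta> \<phi>))"
    using "12.prems" by (intro peventually_conj peventually_push[OF M]) (auto simp: IH)
  then show ?case
    unfolding push_ok_def
    by (auto simp: IH pquantify_upd image_subset_iff elim!: peventually_mono)
qed

theorem theorem1:
  fixes Q :: pfx and \<phi> :: "'p sform"
  assumes "admissible Q" and "state_formula (prefixed Q \<phi>)"
  shows "equiv_fin TYPE(('ag, 's, 'p) hdmas) (push Q \<phi>) (prefixed Q \<phi>)"
proof -
  have \<phi>: "state_formula \<phi>"
    using assms(2) by (cases Q) simp_all
  \<comment> \<open>For two quantifiers \<open>i \<noteq> j\<close>, so the inner one hides no free
    occurrence of the outer variable.\<close>
  have "positive_in y \<phi>" if "y \<in> pfx_vars Q" for y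
  proof (cases Q)
    case (Two q i q' j)
    then show ?thesis using assms that by (auto simp: positive_in_def)
  qed (use assms that in simp)
  then have d: "aligned (y = Y1) y (neg_depths y \<phi>)" if "y \<in> pfx_vars Q" for y
    using aligned_positive that by metis
  show ?thesis
    unfolding equiv_fin_def sat_prefixed
    by (intro allI impI, elim conjE)
      (rule sat_push(1)[where d = "\<lambda>y. y = Y1", OF _ _ assms(1) \<phi> d])
qed

end
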